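(* Let $P$ be a commutative, absolute topological ring. Then for every finite preordered set $\Lambda$, $\mathrm{M}_\Lambda(P)$ is an absolute topological ring.
   Context: Rings are associative with identity; topological rings and groups are Hausdorff. An absolute topological ring is a topological ring whose group of units, with the subspace topology, is a topological group. For a finite preordered set $(\Lambda,\preceq)$, $\mathrm{M}_\Lambda(P)=\{(a_{s_1,s_2})\in P^{\Lambda\times\Lambda}: a_{s_1,s_2}\neq 0\Rightarrow s_1\preceq s_2\}$ with coordinatewise addition, product $(ab)_{s_1,s_2}=\sum_{s_1\preceq t\preceq s_2}a_{s_1,t}b_{t,s_2}$, and the subspace topology from the product space $P^{\Lambda\times\Lambda}$. *)

theory Defs
  imports "HOL-Analysis.Analysis" "HOL-Algebra.Ring"
begin

text \<open>
  Rings are those of HOL-Algebra, so the zero ring is allowed (it occurs as the matrix ring over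
  the empty index set). A topology is an explicit topology on the carrier.
\<close>

definition topological_group :: "('a, 'm) monoid_scheme \<Rightarrow> 'a topology \<Rightarrow> bool" where
  "topological_group G T \<longleftrightarrow>
     group G \<and> topspace T = carrier G \<and> Hausdorff_space T \<and>
     continuous_map (prod_topology T T) T (\<lambda>(x, y). x \<otimes>\<^bsub>G\<^esub> y) \<and>
     continuous_map T T (\<lambda>x. inv\<^bsub>G\<^esub> x)"

definition topological_ring :: "('a, 'm) ring_scheme \<Rightarrow> 'a topology \<Rightarrow> bool" where
  "topological_ring R T \<longleftrightarrow>
     ring R \<and> topological_group (add_monoid R) T \<and>
     continuous_map (prod_topology T T) T (\<lambda>(x, y). x \<otimes>\<^bsub>R\<^esub> y)"

definition absolute_topological_ring :: "('a, 'm) ring_scheme \<Rightarrow> 'a topology \<Rightarrow> bool" where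
  "absolute_topological_ring R T \<longleftrightarrow>
     topological_ring R T \<and> topological_group (units_of R) (subtopology T (Units R))"

text \<open>
  The preorder on \<open>\<Lambda>\<close> is a relation \<open>r\<close>, with \<open>(s, t) \<in> r\<close> meaning that \<open>s\<close> precedes \<open>t\<close>.
  Matrices are functions on pairs of indices that are undefined outside \<open>\<Lambda> \<times> \<Lambda>\<close>, as
  required of the points of a \<^const>\<open>product_topology\<close>.
\<close>

definition preorder_matrix_ring ::
  "'i set \<Rightarrow> 'i rel \<Rightarrow> ('a, 'm) ring_scheme \<Rightarrow> ('i \<times> 'i \<Rightarrow> 'a) ring" where
  "preorder_matrix_ring \<Lambda> r P =
     \<lparr>carrier = {a \<in> \<Lambda> \<times> \<Lambda> \<rightarrow>\<^sub>E carrier P.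
         \<forall>s\<in>\<Lambda>. \<forall>t\<in>\<Lambda>. a (s, t) \<noteq> \<zero>\<^bsub>P\<^esub> \<longrightarrow> (s, t) \<in> r},
      mult = (\<lambda>a b. \<lambda>(s, u)\<in>\<Lambda> \<times> \<Lambda>.
         \<Oplus>\<^bsub>P\<^esub>t\<in>{t \<in> \<Lambda>. (s, t) \<in> r \<and> (t, u) \<in> r}. a (s, t) \<otimes>\<^bsub>P\<^esub> b (t, u)),
      one = (\<lambda>(s, t)\<in>\<Lambda> \<times> \<Lambda>. if s = t then \<one>\<^bsub>P\<^esub> else \<zero>\<^bsub>P\<^esub>),
      zero = (\<lambda>_\<in>\<Lambda> \<times> \<Lambda>. \<zero>\<^bsub>P\<^esub>),
      add = (\<lambda>a b. \<lambda>p\<in>\<Lambda> \<times> \<Lambda>. a p \<oplus>\<^bsub>P\<^esub> b p)\<rparr>"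

definition preorder_matrix_topology ::
  "'i set \<Rightarrow> 'i rel \<Rightarrow> ('a, 'm) ring_scheme \<Rightarrow> 'a topology \<Rightarrow> ('i \<times> 'i \<Rightarrow> 'a) topology" where
  "preorder_matrix_topology \<Lambda> r P T =
     subtopology (product_topology (\<lambda>_. T) (\<Lambda> \<times> \<Lambda>)) (carrier (preorder_matrix_ring \<Lambda> r P))"

end

theory Submission
  imports Defs "HOL-Combinatorics.Permutations"
begin

text \<open>
  Only inversion needs an argument. The determinant of an invertible matrix \<open>a\<close> is a unit of \<open>P\<close>,
  and by Cramer's rule every entry of the inverse of \<open>a\<close> is the inverse of \<open>det a\<close> times a
  polynomial in the entries of \<open>a\<close>; so it depends continuously on \<open>a\<close>, because inversion is
  continuous on the units of \<open>P\<close>. The determinant is that of all \<open>\<Lambda> \<times> \<Lambda>\<close> matrices: the auxiliary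
  matrices in Cramer's rule need not respect the preorder.
\<close>

text \<open>The obstacle is that the hypothesis gives continuity of inversion only for single units
  of \<open>P\<close>, while a matrix is inverted all at once. The determinant concentrates that
  inversion in one element of \<open>P\<close>; all other operations are finite sums and products of
  entries. Its multiplicativity, where commutativity enters, yields both facts required:
  \<open>det a\<close> is a unit, and Cramer's rule holds. No minors or adjugate are formed, since
  the inverse is already given and only its entries have to be recovered. The index set carries no
  linear order, which suggests the sum over permutations rather than expansion along rows. The
  preorder does not interfere: terms outside the prescribed range of summation vanish, so the
  product is the ordinary matrix product and an inverse in the preorder matrix ring is an ordinary
  inverse matrix.\<close>

section \<open>Iterated finite products and sums\<close>

lemma (in comm_monoid) finprod_Sigma:
  assumes "finite A" "\<And>i. i \<in> A \<Longrightarrow> finite (B i)"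
    and "\<And>i j. i \<in> A \<Longrightarrow> j \<in> B i \<Longrightarrow> f (i, j) \<in> carrier G"
  shows "(\<Otimes>p\<in>Sigma A B. f p) = (\<Otimes>i\<in>A. \<Otimes>j\<in>B i. f (i, j))"
  using assms
proof (induction A)
  case (insert x A)
  have *: "Sigma (insert x A) B = Pair x ` B x \<union> Sigma A B"
    by auto
  have "(\<Otimes>p\<in>Pair x ` B x. f p) = (\<Otimes>j\<in>B x. f (x, j))"
    using insert.prems by (subst finprod_reindex) (auto simp: inj_on_def)
  moreover have "(\<Otimes>p\<in>Sigma (insert x A) B. f p) =
      (\<Otimes>p\<in>Pair x ` B x. f p) \<otimes> (\<Otimes>p\<in>Sigma A B. f p)"
    unfolding * by (rule finprod_Un_disjoint) (use insert in auto)
  ultimately show ?case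
    using insert by (simp add: Pi_iff)
qed auto

lemma (in comm_monoid) finprod_swap:
  assumes "finite A" "finite B"
    and "\<And>i j. i \<in> A \<Longrightarrow> j \<in> B \<Longrightarrow> f i j \<in> carrier G"
  shows "(\<Otimes>i\<in>A. \<Otimes>j\<in>B. f i j) = (\<Otimes>j\<in>B. \<Otimes>i\<in>A. f i j)"
  using assms(1,3)
proof (induction A)
  case (insert x A)
  then have "(\<Otimes>i\<in>insert x A. \<Otimes>j\<in>B. f i j) = (\<Otimes>j\<in>B. f x j) \<otimes> (\<Otimes>j\<in>B. \<Otimes>i\<in>A. f i j)"
    by (simp add: Pi_iff)
  also have "\<dots> = (\<Otimes>j\<in>B. f x j \<otimes> (\<Otimes>i\<in>A. f i j))"
    using insert.prems by (subst finprod_multf) (auto simp: Pi_iff)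
  also have "\<dots> = (\<Otimes>j\<in>B. \<Otimes>i\<in>insert x A. f i j)"
    using insert by (intro finprod_cong') (auto simp: Pi_iff)
  finally show ?case .
qed auto

lemmas (in abelian_monoid) finsum_Sigma = add.finprod_Sigma
lemmas (in abelian_monoid) finsum_swap = add.finprod_swap

context cring
begin

text \<open>Expanding a product of sums means choosing one summand \<open>h i\<close> from each
  factor. For determinants this turns a product of row sums into a sum over all self-maps of the
  index set, most of which cancel later. Extensional functions make the choices finite in number and
  count each one once.\<close>

lemma finprod_finsum_distrib:
  assumes "finite A" "finite S"
    and "\<And>i k. i \<in> A \<Longrightarrow> k \<in> S \<Longrightarrow> f i k \<in> carrier R"
  shows "(\<Otimes>i\<in>A. \<Oplus>k\<in>S. f i k) = (\<Oplus>h\<in>A \<rightarrow>\<^sub>E S. \<Otimes>i\<in>A. f i (h i))"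
  using assms(1,3)
proof (induction A)
  case (insert x A)
  let ?H = "A \<rightarrow>\<^sub>E S"
  have finH: "finite ?H"
    using insert.hyps assms(2) by (simp add: finite_PiE)
  have fc: "(\<Otimes>i\<in>A. f i (h i)) \<in> carrier R" if "h \<in> ?H" for h
    using insert.prems that by (intro finprod_closed) (auto simp: PiE_iff)
  have upd: "(\<Otimes>i\<in>insert x A. f i ((h(x := k)) i)) = f x k \<otimes> (\<Otimes>i\<in>A. f i (h i))"
    if "h \<in> ?H" "k \<in> S" for h k
  proof -
    have "(\<Otimes>i\<in>A. f i ((h(x := k)) i)) = (\<Otimes>i\<in>A. f i (h i))"
      using insert that by (intro finprod_cong') (auto simp: PiE_iff)
    moreover have "(\<Otimes>i\<in>insert x A. f i ((h(x := k)) i)) =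
        f x ((h(x := k)) x) \<otimes> (\<Otimes>i\<in>A. f i ((h(x := k)) i))"
      using insert that by (intro finprod_insert) (auto simp: PiE_iff Pi_iff)
    ultimately show ?thesis by simp
  qed
  have "(\<Otimes>i\<in>insert x A. \<Oplus>k\<in>S. f i k) = (\<Oplus>k\<in>S. f x k) \<otimes> (\<Oplus>h\<in>?H. \<Otimes>i\<in>A. f i (h i))"
    using insert by (simp add: Pi_iff)
  also have "\<dots> = (\<Oplus>k\<in>S. f x k \<otimes> (\<Oplus>h\<in>?H. \<Otimes>i\<in>A. f i (h i)))"
    using insert.prems fc assms(2) by (intro finsum_ldistr) (auto simp: Pi_iff)
  also have "\<dots> = (\<Oplus>k\<in>S. \<Oplus>h\<in>?H. f x k \<otimes> (\<Otimes>i\<in>A. f i (h i)))"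
    using insert.prems fc finH by (intro finsum_cong' finsum_rdistr) (auto simp: Pi_iff)
  also have "\<dots> = (\<Oplus>p\<in>S \<times> ?H. f x (fst p) \<otimes> (\<Otimes>i\<in>A. f i (snd p i)))"
    using insert.prems fc finH assms(2) by (subst finsum_Sigma) auto
  also have "\<dots> = (\<Oplus>p\<in>S \<times> ?H. \<Otimes>i\<in>insert x A. f i (((\<lambda>(y, g). g(x := y)) p) i))"
    using upd insert.prems fc by (intro finsum_cong') (auto simp: Pi_iff)
  \<comment> \<open>A choice on \<open>insert x A\<close> is a choice on \<open>A\<close> together
    with a value at \<open>x\<close>; since \<open>x\<close> is not in \<open>A\<close>, the update
    map on pairs is injective and the sum can be reindexed.\<close>
  also have "\<dots> = (\<Oplus>h\<in>insert x A \<rightarrow>\<^sub>E S. \<Otimes>i\<in>insert x A. f i (h i))"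
    unfolding PiE_insert_eq
    by (subst finsum_reindex)
      (use insert inj_combinator[OF insert.hyps(2), of "\<lambda>_. S"] in
        \<open>auto simp: PiE_iff intro!: finprod_closed m_closed\<close>)
  finally show ?case .
qed (use assms in auto)

section \<open>Determinants as sums over permutations, and their multiplicativity\<close>

text \<open>The sign takes its values in the ring so that it can multiply entries directly. Parity
  behaves well only for permutations of finite support, whence the finiteness of the index set in
  the product rule.\<close>

definition perm_sign :: "('i \<Rightarrow> 'i) \<Rightarrow> 'a" where
  "perm_sign \<pi> = (if evenperm \<pi> then \<one> else \<ominus> \<one>)"

lemma perm_sign_closed [simp]: "perm_sign \<pi> \<in> carrier R"
  by (simp add: perm_sign_def)

lemma perm_sign_compose:
  assumes "finite S" "\<pi> permutes S" "\<sigma> permutes S"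
  shows "perm_sign (\<pi> \<circ> \<sigma>) = perm_sign \<pi> \<otimes> perm_sign \<sigma>"
  using assms evenperm_comp[of \<pi> \<sigma>] by (auto simp: perm_sign_def permutation_permutes l_minus)

text \<open>This is the Leibniz formula, with \<open>i\<close> as row and \<open>\<pi> i\<close> as
  column. Only the entries on \<open>S \<times> S\<close> matter, so matrices may be arbitrary
  functions elsewhere.\<close>

definition perm_det :: "'i set \<Rightarrow> ('i \<times> 'i \<Rightarrow> 'a) \<Rightarrow> 'a" where
  "perm_det S a = (\<Oplus>\<pi>\<in>{\<pi>. \<pi> permutes S}. perm_sign \<pi> \<otimes> (\<Otimes>i\<in>S. a (i, \<pi> i)))"

lemma perm_prod_closed:
  assumes "\<And>i j. i \<in> S \<Longrightarrow> j \<in> S \<Longrightarrow> a (i, j) \<in> carrier R" "f \<in> S \<rightarrow> S" "\<pi> permutes S"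
  shows "(\<Otimes>i\<in>S. a (f i, \<pi> i)) \<in> carrier R"
  using assms by (intro finprod_closed) (auto simp: permutes_in_image Pi_iff)

lemma perm_det_closed:
  assumes "\<And>i j. i \<in> S \<Longrightarrow> j \<in> S \<Longrightarrow> a (i, j) \<in> carrier R"
  shows "perm_det S a \<in> carrier R"
  unfolding perm_det_def
  using perm_prod_closed[of S a "\<lambda>i. i"] assms by (intro finsum_closed) auto

text \<open>Substituting \<open>\<pi> \<circ> \<sigma>\<close> for \<open>\<pi>\<close> permutes the
  summation range; each product then becomes the one for \<open>\<pi>\<close> after reindexing the
  rows by \<open>\<sigma>\<close>, and the sign contributes the factor
  \<open>perm_sign \<sigma>\<close>.\<close>

lemma perm_det_permute_rows:
  assumes "finite S" "\<And>i j. i \<in> S \<Longrightarrow> j \<in> S \<Longrightarrow> a (i, j) \<in> carrier R" "\<sigma> permutes S"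
  shows "(\<Oplus>\<pi>\<in>{\<pi>. \<pi> permutes S}. perm_sign \<pi> \<otimes> (\<Otimes>i\<in>S. a (\<sigma> i, \<pi> i)))
    = perm_sign \<sigma> \<otimes> perm_det S a"
proof -
  let ?Q = "{\<pi>. \<pi> permutes S}"
  let ?g = "\<lambda>\<pi>. perm_sign \<pi> \<otimes> (\<Otimes>i\<in>S. a (\<sigma> i, \<pi> i))"
  have \<sigma>: "\<sigma> \<in> S \<rightarrow> S"
    using assms(3) by (auto simp: permutes_in_image)
  have clo: "(\<Otimes>i\<in>S. a (\<tau> i, \<pi> i)) \<in> carrier R" if "\<tau> permutes S" "\<pi> permutes S" for \<tau> \<pi>
    using that by (intro perm_prod_closed assms) (auto simp: permutes_in_image)
  have clo': "(\<Otimes>i\<in>S. a (i, \<pi> i)) \<in> carrier R" if "\<pi> permutes S" for \<pi>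
    using that by (intro perm_prod_closed assms) auto
  have inj: "inj_on (\<lambda>\<pi>. \<pi> \<circ> \<sigma>) ?Q"
    using permutes_surj[OF assms(3)] by (auto simp: inj_on_def surj_fun_eq fun_eq_iff) (metis surjD)
  have im: "(\<lambda>\<pi>. \<pi> \<circ> \<sigma>) ` ?Q = ?Q"
  proof -
    have "\<pi> \<in> (\<lambda>\<pi>. \<pi> \<circ> \<sigma>) ` ?Q" if "\<pi> permutes S" for \<pi>
    proof
      show "\<pi> = (\<pi> \<circ> inv_into UNIV \<sigma>) \<circ> \<sigma>"
        using permutes_inv_o[OF assms(3)] by (simp add: comp_assoc)
      show "\<pi> \<circ> inv_into UNIV \<sigma> \<in> ?Q"
        using permutes_compose[OF permutes_inv[OF assms(3)] that] by simp
    qed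
    then show ?thesis
      using permutes_compose[OF assms(3)] by auto
  qed
  have eq: "?g (\<pi> \<circ> \<sigma>) = perm_sign \<sigma> \<otimes> (perm_sign \<pi> \<otimes> (\<Otimes>i\<in>S. a (i, \<pi> i)))"
    if "\<pi> permutes S" for \<pi>
  proof -
    have "(\<Otimes>j\<in>\<sigma> ` S. a (j, \<pi> j)) = (\<Otimes>i\<in>S. a (\<sigma> i, \<pi> (\<sigma> i)))"
      using that assms(2) permutes_inj_on[OF assms(3)] permutes_image[OF assms(3)]
      by (intro finprod_reindex) (auto simp: permutes_in_image)
    then have "(\<Otimes>i\<in>S. a (\<sigma> i, (\<pi> \<circ> \<sigma>) i)) = (\<Otimes>i\<in>S. a (i, \<pi> i))"
      using permutes_image[OF assms(3)] by simp
    then show ?thesis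
      using clo'[OF that] by (simp add: perm_sign_compose[OF assms(1) that assms(3)] m_ac)
  qed
  have "(\<Oplus>\<pi>\<in>?Q. ?g \<pi>) = (\<Oplus>\<pi>\<in>?Q. ?g (\<pi> \<circ> \<sigma>))"
    using finsum_reindex[OF _ inj, of ?g] clo[OF assms(3)] unfolding im by auto
  also have "\<dots> = (\<Oplus>\<pi>\<in>?Q. perm_sign \<sigma> \<otimes> (perm_sign \<pi> \<otimes> (\<Otimes>i\<in>S. a (i, \<pi> i))))"
    using eq clo' by (intro finsum_cong') auto
  also have "\<dots> = perm_sign \<sigma> \<otimes> perm_det S a"
    unfolding perm_det_def using clo' assms(1)
    by (intro finsum_rdistr[symmetric]) (auto simp: finite_permutations)
  finally show ?thesis .
qed

text \<open>Composing with the transposition of \<open>p\<close> and \<open>q\<close> pairs the even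
  permutations with the odd ones. It leaves the product of entries unchanged because
  \<open>f\<close> does not distinguish \<open>p\<close> from \<open>q\<close>, and it flips the
  sign, so each pair cancels. Explicit cancellation is used because showing that the sum equals its
  own negative would not suffice when 2 is a zero divisor.\<close>

lemma perm_det_repeated_row:
  assumes "finite S" "\<And>i j. i \<in> S \<Longrightarrow> j \<in> S \<Longrightarrow> a (i, j) \<in> carrier R" "f \<in> S \<rightarrow> S"
    and pq: "p \<in> S" "q \<in> S" "p \<noteq> q" "f p = f q"
  shows "(\<Oplus>\<pi>\<in>{\<pi>. \<pi> permutes S}. perm_sign \<pi> \<otimes> (\<Otimes>i\<in>S. a (f i, \<pi> i))) = \<zero>"
proof -
  let ?E = "{\<pi>. \<pi> permutes S \<and> evenperm \<pi>}" and ?O = "{\<pi>. \<pi> permutes S \<and> \<not> evenperm \<pi>}"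
  let ?g = "\<lambda>\<pi>. perm_sign \<pi> \<otimes> (\<Otimes>i\<in>S. a (f i, \<pi> i))"
  define \<tau> where "\<tau> = Transposition.transpose p q"
  have \<tau>: "\<tau> permutes S"
    unfolding \<tau>_def using pq by (intro permutes_swap_id) auto
  have \<tau>\<tau>: "\<tau> \<circ> \<tau> = id"
    by (simp add: \<tau>_def)
  have odd: "\<not> evenperm \<tau>"
    using pq by (simp add: \<tau>_def evenperm_swap)
  have clo: "(\<Otimes>i\<in>S. a (f i, \<pi> i)) \<in> carrier R" if "\<pi> permutes S" for \<pi>
    using that by (intro perm_prod_closed assms)
  have fin: "finite ?E" "finite ?O"
    using finite_permutations[OF assms(1)] by (auto intro: finite_subset[rotated])
  have flip: "evenperm (\<pi> \<circ> \<tau>) \<longleftrightarrow> \<not> evenperm \<pi>" if "\<pi> permutes S" for \<pi>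
    using that \<tau> odd assms(1) evenperm_comp[of \<pi> \<tau>] permutation_permutes by blast
  have eq: "?g (\<pi> \<circ> \<tau>) = \<ominus> ?g \<pi>" if "\<pi> permutes S" for \<pi>
  proof -
    have "(\<Otimes>j\<in>\<tau> ` S. a (f j, \<pi> j)) = (\<Otimes>i\<in>S. a (f (\<tau> i), \<pi> (\<tau> i)))"
      using that assms(2,3) permutes_inj_on[OF \<tau>] permutes_image[OF \<tau>]
      by (intro finprod_reindex) (auto simp: permutes_in_image Pi_iff)
    moreover have "f (\<tau> i) = f i" for i
      using pq by (auto simp: \<tau>_def Transposition.transpose_def)
    ultimately have "(\<Otimes>i\<in>S. a (f i, (\<pi> \<circ> \<tau>) i)) = (\<Otimes>i\<in>S. a (f i, \<pi> i))"
      using permutes_image[OF \<tau>] by simp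
    moreover have "perm_sign (\<pi> \<circ> \<tau>) = \<ominus> perm_sign \<pi>"
      using flip[OF that] by (simp add: perm_sign_def)
    ultimately show ?thesis
      using clo[OF that] by (simp add: l_minus)
  qed
  have inj: "inj_on (\<lambda>\<pi>. \<pi> \<circ> \<tau>) ?E"
    using \<tau>\<tau> by (intro inj_on_inverseI[where g = "\<lambda>\<pi>. \<pi> \<circ> \<tau>"]) (simp add: comp_assoc)
  have im: "(\<lambda>\<pi>. \<pi> \<circ> \<tau>) ` ?E = ?O"
  proof -
    have "\<pi> \<in> (\<lambda>\<pi>. \<pi> \<circ> \<tau>) ` ?E" if "\<pi> \<in> ?O" for \<pi>
    proof
      show "\<pi> = (\<pi> \<circ> \<tau>) \<circ> \<tau>"
        using \<tau>\<tau> by (simp add: comp_assoc)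
      show "\<pi> \<circ> \<tau> \<in> ?E"
        using that permutes_compose[OF \<tau>] flip by auto
    qed
    then show ?thesis
      using permutes_compose[OF \<tau>] flip by auto
  qed
  have "(\<Oplus>\<pi>\<in>?O. ?g \<pi>) = (\<Oplus>\<pi>\<in>?E. ?g (\<pi> \<circ> \<tau>))"
    using finsum_reindex[OF _ inj, of ?g] clo unfolding im by auto
  also have "\<dots> = (\<Oplus>\<pi>\<in>?E. \<ominus> ?g \<pi>)"
    using eq clo by (intro finsum_cong') auto
  finally have "(\<Oplus>\<pi>\<in>?E. ?g \<pi>) \<oplus> (\<Oplus>\<pi>\<in>?O. ?g \<pi>) = (\<Oplus>\<pi>\<in>?E. ?g \<pi> \<oplus> \<ominus> ?g \<pi>)"
    using clo by (subst finsum_addf) auto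
  also have "\<dots> = \<zero>"
    using clo by (intro add.finprod_one_eqI) (auto simp: r_neg)
  also have "(\<Oplus>\<pi>\<in>?E. ?g \<pi>) \<oplus> (\<Oplus>\<pi>\<in>?O. ?g \<pi>) = (\<Oplus>\<pi>\<in>?E \<union> ?O. ?g \<pi>)"
    using clo fin by (intro finsum_Un_disjoint[symmetric]) auto
  also have "?E \<union> ?O = {\<pi>. \<pi> permutes S}"
    by auto
  finally show ?thesis .
qed

text \<open>Expanding every row of the product gives a sum over self-maps \<open>h\<close> of
  \<open>S\<close>, in which the inner sum is the determinant of \<open>b\<close> with its rows
  rearranged by \<open>h\<close>. It vanishes when \<open>h\<close> repeats a row; the remaining
  \<open>h\<close> are permutations and contribute their sign times
  \<open>perm_det S b\<close>.\<close>

lemma perm_det_mult: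
  assumes S: "finite S"
    and a: "\<And>i j. i \<in> S \<Longrightarrow> j \<in> S \<Longrightarrow> a (i, j) \<in> carrier R"
    and b: "\<And>i j. i \<in> S \<Longrightarrow> j \<in> S \<Longrightarrow> b (i, j) \<in> carrier R"
    and c: "\<And>i j. i \<in> S \<Longrightarrow> j \<in> S \<Longrightarrow> c (i, j) = (\<Oplus>k\<in>S. a (i, k) \<otimes> b (k, j))"
  shows "perm_det S c = perm_det S a \<otimes> perm_det S b"
proof -
  let ?Q = "{\<pi>. \<pi> permutes S}" and ?F = "S \<rightarrow>\<^sub>E S"
  let ?A = "\<lambda>h. \<Otimes>i\<in>S. a (i, h i)" and ?B = "\<lambda>h \<pi>. \<Otimes>i\<in>S. b (h i, \<pi> i)"
  let ?G = "\<lambda>h. ?A h \<otimes> (\<Oplus>\<pi>\<in>?Q. perm_sign \<pi> \<otimes> ?B h \<pi>)"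
  have fin: "finite ?Q" "finite ?F"
    using S by (auto simp: finite_permutations finite_PiE)
  have Ac: "?A h \<in> carrier R" if "h \<in> S \<rightarrow> S" for h
    using that a by (intro finprod_closed) auto
  have Bc: "?B h \<pi> \<in> carrier R" if "h \<in> S \<rightarrow> S" "\<pi> permutes S" for h \<pi>
    using that b by (intro perm_prod_closed)
  have FS: "h \<in> S \<rightarrow> S" if "h \<in> ?F" for h
    using that by (auto simp: PiE_iff)
  have QS: "\<sigma> \<in> S \<rightarrow> S" if "\<sigma> permutes S" for \<sigma>
    using that by (auto simp: permutes_in_image)
  have Gc: "?G h \<in> carrier R" if "h \<in> S \<rightarrow> S" for h
    using Ac Bc that by (auto intro!: finsum_closed m_closed)
  have expand: "perm_sign \<pi> \<otimes> (\<Otimes>i\<in>S. c (i, \<pi> i)) =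
      (\<Oplus>h\<in>?F. ?A h \<otimes> (perm_sign \<pi> \<otimes> ?B h \<pi>))" if \<pi>: "\<pi> permutes S" for \<pi>
  proof -
    have "(\<Otimes>i\<in>S. c (i, \<pi> i)) = (\<Otimes>i\<in>S. \<Oplus>k\<in>S. a (i, k) \<otimes> b (k, \<pi> i))"
      using \<pi> a b c by (intro finprod_cong') (auto simp: permutes_in_image intro!: finsum_closed)
    also have "\<dots> = (\<Oplus>h\<in>?F. \<Otimes>i\<in>S. a (i, h i) \<otimes> b (h i, \<pi> i))"
      using \<pi> a b S by (intro finprod_finsum_distrib) (auto simp: permutes_in_image)
    also have "\<dots> = (\<Oplus>h\<in>?F. ?A h \<otimes> ?B h \<pi>)"
      using \<pi> a b Ac Bc FS
      by (intro finsum_cong' finprod_multf) (auto simp: permutes_in_image PiE_iff)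
    finally have "perm_sign \<pi> \<otimes> (\<Otimes>i\<in>S. c (i, \<pi> i)) =
        (\<Oplus>h\<in>?F. perm_sign \<pi> \<otimes> (?A h \<otimes> ?B h \<pi>))"
      using Ac Bc FS \<pi> fin by (simp add: finsum_rdistr Pi_iff)
    also have "\<dots> = (\<Oplus>h\<in>?F. ?A h \<otimes> (perm_sign \<pi> \<otimes> ?B h \<pi>))"
      using Ac Bc FS \<pi> by (intro finsum_cong') (auto simp: m_lcomm)
    finally show ?thesis .
  qed
  have "perm_det S c = (\<Oplus>\<pi>\<in>?Q. \<Oplus>h\<in>?F. ?A h \<otimes> (perm_sign \<pi> \<otimes> ?B h \<pi>))"
    unfolding perm_det_def using expand Ac Bc FS
    by (intro finsum_cong') (auto intro!: finsum_closed m_closed)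
  also have "\<dots> = (\<Oplus>h\<in>?F. \<Oplus>\<pi>\<in>?Q. ?A h \<otimes> (perm_sign \<pi> \<otimes> ?B h \<pi>))"
    using fin Ac Bc FS by (intro finsum_swap) auto
  also have "\<dots> = (\<Oplus>h\<in>?F. ?G h)"
    using fin Ac Bc FS
    by (intro finsum_cong' finsum_rdistr[symmetric]) (auto intro!: finsum_closed m_closed)
  also have "\<dots> = (\<Oplus>h\<in>(\<lambda>\<sigma>. restrict \<sigma> S) ` ?Q. ?G h)"
  proof (rule add.finprod_mono_neutral_cong_right)
    fix h assume h: "h \<in> ?F - (\<lambda>\<sigma>. restrict \<sigma> S) ` ?Q"
    have "\<not> inj_on h S"
    proof
      assume inj: "inj_on h S"
      \<comment> \<open>An injective self-map of a finite set is bijective. Extending it by the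
        identity outside \<open>S\<close> gives the form that \<open>permutes\<close> demands,
        contradicting the choice of \<open>h\<close>.\<close>
      define \<sigma> where "\<sigma> = (\<lambda>i. if i \<in> S then h i else i)"
      have "h ` S \<subseteq> S"
        using h by (auto simp: PiE_iff)
      then have "bij_betw h S S"
        using inj S by (simp add: bij_betw_def endo_inj_surj)
      then have "bij_betw \<sigma> S S"
        by (rule bij_betw_cong[THEN iffD1, rotated]) (simp add: \<sigma>_def)
      then have "\<sigma> permutes S"
        by (rule bij_imp_permutes) (simp add: \<sigma>_def)
      moreover have "h = restrict \<sigma> S"
        using h by (auto simp: \<sigma>_def fun_eq_iff PiE_iff extensional_def)
      ultimately show False
        using h by auto
    qed
    then obtain p q where "p \<in> S" "q \<in> S" "p \<noteq> q" "h p = h q"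
      by (auto simp: inj_on_def)
    then show "?G h = \<zero>"
      using perm_det_repeated_row[of S b h p q] S b h FS Ac by auto
  qed (use fin Gc FS in \<open>auto simp: permutes_in_image\<close>)
  also have "\<dots> = (\<Oplus>\<sigma>\<in>?Q. ?G (restrict \<sigma> S))"
  proof (rule finsum_reindex)
    \<comment> \<open>A permutation of \<open>S\<close> fixes everything outside \<open>S\<close>,
      so its restriction determines it.\<close>
    show "inj_on (\<lambda>\<sigma>. restrict \<sigma> S) ?Q"
    proof (rule inj_onI, rule ext)
      fix \<sigma> \<sigma>' i
      assume "\<sigma> \<in> ?Q" "\<sigma>' \<in> ?Q" "restrict \<sigma> S = restrict \<sigma>' S"
      then show "\<sigma> i = \<sigma>' i"
        by (cases "i \<in> S") (auto simp: permutes_def dest: fun_cong[of _ _ i])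
    qed
  qed (use Gc QS in auto)
  also have "\<dots> = (\<Oplus>\<sigma>\<in>?Q. (perm_sign \<sigma> \<otimes> ?A \<sigma>) \<otimes> perm_det S b)"
  proof (rule finsum_cong')
    fix \<sigma> assume \<sigma>: "\<sigma> \<in> ?Q"
    have "?A (restrict \<sigma> S) = ?A \<sigma>"
      using a \<sigma> by (intro finprod_cong') (auto simp: permutes_in_image)
    moreover have "?B (restrict \<sigma> S) \<pi> = ?B \<sigma> \<pi>" if "\<pi> \<in> ?Q" for \<pi>
      using b \<sigma> that by (intro finprod_cong') (auto simp: permutes_in_image)
    then have "(\<Oplus>\<pi>\<in>?Q. perm_sign \<pi> \<otimes> ?B (restrict \<sigma> S) \<pi>) =
        (\<Oplus>\<pi>\<in>?Q. perm_sign \<pi> \<otimes> ?B \<sigma> \<pi>)"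
      using Bc QS \<sigma> by (intro finsum_cong') auto
    moreover have "\<dots> = perm_sign \<sigma> \<otimes> perm_det S b"
      using \<sigma> S b by (intro perm_det_permute_rows) auto
    ultimately show "?G (restrict \<sigma> S) = (perm_sign \<sigma> \<otimes> ?A \<sigma>) \<otimes> perm_det S b"
      using Ac QS \<sigma> perm_det_closed[of S b] b by (simp add: m_ac)
  qed (use Ac QS perm_det_closed[of S b] b in auto)
  also have "\<dots> = perm_det S a \<otimes> perm_det S b"
    unfolding perm_det_def[of S a] using Ac QS perm_det_closed[of S b] b fin
    by (intro finsum_ldistr[symmetric]) auto
  finally show ?thesis .
qed

text \<open>A permutation other than the identity moves some index to an index different from \<open>k\<close>, and
  so picks up an entry \<open>\<zero>\<close>.\<close>

lemma perm_det_identity_column: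
  assumes S: "finite S" "k \<in> S"
    and x: "\<And>i. i \<in> S \<Longrightarrow> x i \<in> carrier R"
  shows "perm_det S (\<lambda>(i, j). if j = k then x i else if i = j then \<one> else \<zero>) = x k"
proof -
  let ?a = "\<lambda>(i, j). if j = k then x i else if i = j then \<one> else \<zero>"
  let ?Q = "{\<pi>. \<pi> permutes S}"
  let ?g = "\<lambda>\<pi>. perm_sign \<pi> \<otimes> (\<Otimes>i\<in>S. ?a (i, \<pi> i))"
  have ac: "?a (i, j) \<in> carrier R" if "i \<in> S" "j \<in> S" for i j
    using x that by auto
  have clo: "(\<Otimes>i\<in>S. ?a (i, \<pi> i)) \<in> carrier R" if "\<pi> permutes S" for \<pi>
    using perm_prod_closed[of S ?a "\<lambda>i. i" \<pi>] ac that by simp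
  have "(\<Oplus>\<pi>\<in>?Q. ?g \<pi>) = (\<Oplus>\<pi>\<in>{id}. ?g \<pi>)"
  proof (rule add.finprod_mono_neutral_cong_right)
    fix \<pi> assume \<pi>: "\<pi> \<in> ?Q - {id}"
    have "\<exists>i\<in>S. \<pi> i \<noteq> k \<and> \<pi> i \<noteq> i"
    proof (rule ccontr)
      assume neg: "\<not> ?thesis"
      \<comment> \<open>Under the negated claim, only the preimage of \<open>k\<close> could be
        moved. If that preimage differed from \<open>k\<close>, then \<open>k\<close> itself would
        be fixed, contradicting injectivity; hence nothing is moved.\<close>
      have "\<pi> i = i" if "i \<noteq> inv_into UNIV \<pi> k" for i
        using neg \<pi> that permutes_inv_eq[of \<pi> S k i] by (cases "i \<in> S") (auto simp: permutes_not_in)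
      moreover have "\<pi> (inv_into UNIV \<pi> k) = k"
        using \<pi> permutes_inverses(1)[of \<pi> S k] by simp
      ultimately have "inv_into UNIV \<pi> k = k"
        using \<pi> by (metis DiffD1 mem_Collect_eq permutes_inv_eq)
      then have "\<pi> = id"
        using \<open>\<pi> (inv_into UNIV \<pi> k) = k\<close> \<open>\<And>i. i \<noteq> inv_into UNIV \<pi> k \<Longrightarrow> \<pi> i = i\<close>
        by (metis eq_id_iff)
      with \<pi> show False by simp
    qed
    then obtain i where i: "i \<in> S" "\<pi> i \<noteq> k" "\<pi> i \<noteq> i"
      by blast
    have "(\<Otimes>j\<in>insert i (S - {i}). ?a (j, \<pi> j)) = ?a (i, \<pi> i) \<otimes> (\<Otimes>j\<in>S - {i}. ?a (j, \<pi> j))"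
      using S i \<pi> ac by (intro finprod_insert) (auto simp: permutes_in_image)
    moreover have "(\<Otimes>j\<in>S - {i}. ?a (j, \<pi> j)) \<in> carrier R"
      using \<pi> ac by (intro finprod_closed) (auto simp: permutes_in_image)
    ultimately show "?g \<pi> = \<zero>"
      using i by (simp add: insert_absorb)
  qed (use S clo in \<open>auto simp: finite_permutations permutes_id\<close>)
  also have "\<dots> = (\<Otimes>i\<in>S. ?a (i, id i))"
    using clo[OF permutes_id] by (subst finsum_insert)
      (auto simp: perm_sign_def simp del: split_conv id_apply)
  also have "\<dots> = (\<Otimes>i\<in>S. if i = k then x i else \<one>)"
    using x by (intro finprod_cong') auto
  also have "\<dots> = x k"
    using S x by (intro finprod_singleton_swap) auto
  finally show ?thesis
    unfolding perm_det_def .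
qed

section \<open>Cramer's rule and determinants of invertible matrices\<close>

lemma finsum_delta_right:
  assumes "finite S" "j \<in> S" "\<And>k. k \<in> S \<Longrightarrow> f k \<in> carrier R"
  shows "(\<Oplus>k\<in>S. f k \<otimes> (if k = j then \<one> else \<zero>)) = f j"
proof -
  have "(\<Oplus>k\<in>S. f k \<otimes> (if k = j then \<one> else \<zero>)) = (\<Oplus>k\<in>S. if k = j then f k else \<zero>)"
    using assms by (intro finsum_cong') auto
  also have "\<dots> = f j"
    using assms by (intro add.finprod_singleton_swap) auto
  finally show ?thesis .
qed

text \<open>Cramer's rule, obtained by multiplying \<open>a\<close> with the identity matrix whose column \<open>i\<close> has
  been replaced by column \<open>k\<close> of \<open>b\<close>.\<close>

lemma perm_det_cramer:
  assumes S: "finite S" "i \<in> S" "k \<in> S"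
    and a: "\<And>i j. i \<in> S \<Longrightarrow> j \<in> S \<Longrightarrow> a (i, j) \<in> carrier R"
    and b: "\<And>i j. i \<in> S \<Longrightarrow> j \<in> S \<Longrightarrow> b (i, j) \<in> carrier R"
    and ab: "\<And>i j. i \<in> S \<Longrightarrow> j \<in> S \<Longrightarrow>
      (\<Oplus>k\<in>S. a (i, k) \<otimes> b (k, j)) = (if i = j then \<one> else \<zero>)"
  shows "perm_det S a \<otimes> b (i, k) =
    perm_det S (\<lambda>(s, t). if t = i then if s = k then \<one> else \<zero> else a (s, t))"
proof -
  \<comment> \<open>Column \<open>i\<close> of the product is column \<open>k\<close> of
    \<open>a\<close> times \<open>b\<close>, which is the identity column at \<open>k\<close>; every
    other column is multiplied by an identity column and remains that of \<open>a\<close>.\<close>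
  have "perm_det S (\<lambda>(s, t). if t = i then if s = k then \<one> else \<zero> else a (s, t)) =
    perm_det S a \<otimes> perm_det S (\<lambda>(s, t). if t = i then b (s, k) else if s = t then \<one> else \<zero>)"
    using S a b ab[OF _ S(3)] by (intro perm_det_mult) (auto simp: finsum_delta_right)
  also have "perm_det S (\<lambda>(s, t). if t = i then b (s, k) else if s = t then \<one> else \<zero>) = b (i, k)"
    using S b by (intro perm_det_identity_column) auto
  finally show ?thesis by simp
qed

lemma perm_det_identity:
  assumes "finite S"
  shows "perm_det S (\<lambda>(i, j). if i = j then \<one> else \<zero>) = \<one>"
proof (cases "S = {}")
  case True
  then show ?thesis by (simp add: perm_det_def perm_sign_def)
next
  case False
  then obtain k where k: "k \<in> S" by blast
  \<comment> \<open>The identity matrix is itself an identity matrix with one replaced column, the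
    replacement being the old column \<open>k\<close>.\<close>
  have "(\<lambda>(i, j). if j = k then if i = k then \<one> else \<zero> else if i = j then \<one> else \<zero>)
      = (\<lambda>(i, j). if i = j then \<one> else \<zero>)"
    by (auto simp: fun_eq_iff)
  then show ?thesis
    using perm_det_identity_column[OF assms k, of "\<lambda>i. if i = k then \<one> else \<zero>"] by simp
qed

text \<open>The determinant of \<open>b\<close> is the inverse, by multiplicativity; a one-sided
  inverse suffices in a commutative ring.\<close>

lemma perm_det_Units:
  assumes S: "finite S"
    and a: "\<And>i j. i \<in> S \<Longrightarrow> j \<in> S \<Longrightarrow> a (i, j) \<in> carrier R"
    and b: "\<And>i j. i \<in> S \<Longrightarrow> j \<in> S \<Longrightarrow> b (i, j) \<in> carrier R"
    and ab: "\<And>i j. i \<in> S \<Longrightarrow> j \<in> S \<Longrightarrow>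
      (\<Oplus>k\<in>S. a (i, k) \<otimes> b (k, j)) = (if i = j then \<one> else \<zero>)"
  shows "perm_det S a \<in> Units R"
proof -
  have "perm_det S a \<otimes> perm_det S b = perm_det S (\<lambda>(i, j). if i = j then \<one> else \<zero>)"
    using S a b ab by (intro perm_det_mult[symmetric]) auto
  then have "perm_det S a \<otimes> perm_det S b = \<one>"
    by (simp add: perm_det_identity S)
  moreover have "perm_det S a \<in> carrier R" "perm_det S b \<in> carrier R"
    using a b by (auto intro: perm_det_closed)
  ultimately show ?thesis
    unfolding Units_def by (auto simp: m_comm intro!: bexI[of _ "perm_det S b"])
qed

end

section \<open>Continuity of finite sums, products and determinants\<close>

lemma continuous_map_binop:
  assumes "continuous_map (prod_topology Y Z) W (\<lambda>(x, y). f x y)"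
    and "continuous_map X Y g" "continuous_map X Z h"
  shows "continuous_map X W (\<lambda>x. f (g x) (h x))"
  using continuous_map_compose[OF continuous_map_pairedI[OF assms(2,3)] assms(1)]
  by (simp add: o_def)

text \<open>Stated for commutative monoids so that the additive instance covers finite sums as well.
  For infinite \<open>I\<close> the product is by convention \<open>\<one>\<close>, a constant
  map.\<close>

lemma (in comm_monoid) continuous_map_finprod:
  assumes T: "topspace T = carrier G" "continuous_map (prod_topology T T) T (\<lambda>(x, y). x \<otimes> y)"
    and f: "\<And>i. i \<in> I \<Longrightarrow> continuous_map X T (\<lambda>x. f x i)"
  shows "continuous_map X T (\<lambda>x. \<Otimes>i\<in>I. f x i)"
  using f
proof (induction I rule: infinite_finite_induct)
  case (insert i I)
  have "continuous_map X T (\<lambda>x. f x i \<otimes> (\<Otimes>j\<in>I. f x j))"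
    using insert by (intro continuous_map_binop[OF T(2)]) auto
  moreover have "f x j \<in> carrier G" if "x \<in> topspace X" "j \<in> insert i I" for x j
    using continuous_map_image_subset_topspace[OF insert.prems[OF that(2)]] that(1) T(1) by auto
  ultimately show ?case
    using insert.hyps by (elim continuous_map_eq) (auto simp: Pi_iff)
qed (use T in auto)

lemma (in cring) continuous_map_perm_det:
  assumes T: "topspace T = carrier R"
      "continuous_map (prod_topology T T) T (\<lambda>(x, y). x \<otimes> y)"
      "continuous_map (prod_topology T T) T (\<lambda>(x, y). x \<oplus> y)"
    and f: "\<And>i j. i \<in> S \<Longrightarrow> j \<in> S \<Longrightarrow> continuous_map X T (\<lambda>x. f x (i, j))"
  shows "continuous_map X T (\<lambda>x. perm_det S (f x))"
  unfolding perm_det_def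
  using T f
  by (intro add.continuous_map_finprod[simplified] continuous_map_binop[OF T(2)]
      continuous_map_finprod) (auto simp: permutes_in_image)

section \<open>The topological ring of preorder matrices\<close>

locale preorder_matrices = ring P for P (structure) +
  fixes \<Lambda> :: "'i set" and r :: "'i rel"
  assumes finite_index: "finite \<Lambda>" and preorder: "preorder_on \<Lambda> r"
begin

abbreviation "M \<equiv> preorder_matrix_ring \<Lambda> r P"

lemma index_refl: "s \<in> \<Lambda> \<Longrightarrow> (s, s) \<in> r"
  using preorder by (simp add: preorder_on_def refl_on_def)

lemma index_trans: "(s, t) \<in> r \<Longrightarrow> (t, u) \<in> r \<Longrightarrow> (s, u) \<in> r"
  using preorder by (auto simp: preorder_on_def dest: transD)

lemma carrier_matrix_iff:
  "a \<in> carrier M \<longleftrightarrow> a \<in> \<Lambda> \<times> \<Lambda> \<rightarrow>\<^sub>E carrier P \<and>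
     (\<forall>s\<in>\<Lambda>. \<forall>t\<in>\<Lambda>. (s, t) \<notin> r \<longrightarrow> a (s, t) = \<zero>)"
  by (auto simp: preorder_matrix_ring_def)

lemma entry_closed: "a \<in> carrier M \<Longrightarrow> s \<in> \<Lambda> \<Longrightarrow> t \<in> \<Lambda> \<Longrightarrow> a (s, t) \<in> carrier P"
  by (auto simp: carrier_matrix_iff PiE_iff)

lemma entry_zero: "a \<in> carrier M \<Longrightarrow> s \<in> \<Lambda> \<Longrightarrow> t \<in> \<Lambda> \<Longrightarrow> (s, t) \<notin> r \<Longrightarrow> a (s, t) = \<zero>"
  by (auto simp: carrier_matrix_iff)

lemma matrix_eqI:
  assumes "a \<in> carrier M" "b \<in> carrier M"
    and "\<And>s t. s \<in> \<Lambda> \<Longrightarrow> t \<in> \<Lambda> \<Longrightarrow> a (s, t) = b (s, t)"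
  shows "a = b"
proof (rule PiE_ext)
  show "a \<in> \<Lambda> \<times> \<Lambda> \<rightarrow>\<^sub>E carrier P" "b \<in> \<Lambda> \<times> \<Lambda> \<rightarrow>\<^sub>E carrier P"
    using assms(1,2) by (simp_all add: carrier_matrix_iff)
qed (use assms(3) in auto)

lemma add_matrix: "a \<oplus>\<^bsub>M\<^esub> b = (\<lambda>p\<in>\<Lambda> \<times> \<Lambda>. a p \<oplus> b p)"
  by (simp add: preorder_matrix_ring_def)

lemma zero_matrix: "\<zero>\<^bsub>M\<^esub> = (\<lambda>_\<in>\<Lambda> \<times> \<Lambda>. \<zero>)"
  by (simp add: preorder_matrix_ring_def)

lemma one_entry: "s \<in> \<Lambda> \<Longrightarrow> t \<in> \<Lambda> \<Longrightarrow> \<one>\<^bsub>M\<^esub> (s, t) = (if s = t then \<one> else \<zero>)"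
  by (simp add: preorder_matrix_ring_def)

text \<open>For an index \<open>t\<close> outside the defining range of summation, one of the two
  factors is zero. The full range makes the usual matrix algebra applicable and matches the
  hypothesis of Cramer's rule.\<close>

lemma mult_entry:
  assumes "a \<in> carrier M" "b \<in> carrier M" "s \<in> \<Lambda>" "u \<in> \<Lambda>"
  shows "(a \<otimes>\<^bsub>M\<^esub> b) (s, u) = (\<Oplus>t\<in>\<Lambda>. a (s, t) \<otimes> b (t, u))"
proof -
  have "(\<Oplus>t\<in>{t \<in> \<Lambda>. (s, t) \<in> r \<and> (t, u) \<in> r}. a (s, t) \<otimes> b (t, u)) =
      (\<Oplus>t\<in>\<Lambda>. a (s, t) \<otimes> b (t, u))"
  proof (rule add.finprod_mono_neutral_cong_left)
    fix t assume "t \<in> \<Lambda> - {t \<in> \<Lambda>. (s, t) \<in> r \<and> (t, u) \<in> r}"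
    then show "a (s, t) \<otimes> b (t, u) = \<zero>"
      using assms entry_zero[of a s t] entry_zero[of b t u] entry_closed[of a s t]
        entry_closed[of b t u] by auto
  qed (use assms finite_index entry_closed in auto)
  then show ?thesis
    using assms(3,4) by (simp add: preorder_matrix_ring_def)
qed

lemma mult_matrix_closed:
  assumes "a \<in> carrier M" "b \<in> carrier M"
  shows "a \<otimes>\<^bsub>M\<^esub> b \<in> carrier M"
proof -
  have "(a \<otimes>\<^bsub>M\<^esub> b) (s, u) \<in> carrier P" if "s \<in> \<Lambda>" "u \<in> \<Lambda>" for s u
    using that assms entry_closed by (auto simp: mult_entry intro!: finsum_closed)
  moreover have "(a \<otimes>\<^bsub>M\<^esub> b) (s, u) = \<zero>" if "s \<in> \<Lambda>" "u \<in> \<Lambda>" "(s, u) \<notin> r" for s u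
  proof -
    \<comment> \<open>By transitivity an intermediate index would force
      \<open>(s, u) \<in> r\<close>, so the entry is an empty sum.\<close>
    have "{t \<in> \<Lambda>. (s, t) \<in> r \<and> (t, u) \<in> r} = {}"
      using that index_trans by blast
    then show ?thesis
      using that by (simp add: preorder_matrix_ring_def del: Collect_empty_eq)
  qed
  moreover have "a \<otimes>\<^bsub>M\<^esub> b \<in> extensional (\<Lambda> \<times> \<Lambda>)"
    by (simp add: preorder_matrix_ring_def)
  ultimately show ?thesis
    by (auto simp: carrier_matrix_iff PiE_iff)
qed

lemma add_matrix_closed:
  "a \<in> carrier M \<Longrightarrow> b \<in> carrier M \<Longrightarrow> a \<oplus>\<^bsub>M\<^esub> b \<in> carrier M"
  by (auto simp: carrier_matrix_iff PiE_iff add_matrix)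

lemma zero_matrix_closed: "\<zero>\<^bsub>M\<^esub> \<in> carrier M"
  by (auto simp: carrier_matrix_iff zero_matrix)

lemma one_matrix_closed: "\<one>\<^bsub>M\<^esub> \<in> carrier M"
  by (auto simp: carrier_matrix_iff preorder_matrix_ring_def PiE_iff index_refl)

lemma uminus_matrix_closed:
  "a \<in> carrier M \<Longrightarrow> (\<lambda>p\<in>\<Lambda> \<times> \<Lambda>. \<ominus> a p) \<in> carrier M"
  by (auto simp: carrier_matrix_iff PiE_iff)

lemma uminus_matrix_l_neg:
  assumes "a \<in> carrier M"
  shows "(\<lambda>p\<in>\<Lambda> \<times> \<Lambda>. \<ominus> a p) \<oplus>\<^bsub>M\<^esub> a = \<zero>\<^bsub>M\<^esub>"
  using entry_closed[OF assms] by (auto simp: add_matrix zero_matrix fun_eq_iff l_neg)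

lemma mult_matrix_assoc:
  assumes "a \<in> carrier M" "b \<in> carrier M" "c \<in> carrier M"
  shows "(a \<otimes>\<^bsub>M\<^esub> b) \<otimes>\<^bsub>M\<^esub> c = a \<otimes>\<^bsub>M\<^esub> (b \<otimes>\<^bsub>M\<^esub> c)"
proof (rule matrix_eqI)
  fix s u assume su: "s \<in> \<Lambda>" "u \<in> \<Lambda>"
  note [simp] = entry_closed[OF assms(1)] entry_closed[OF assms(2)] entry_closed[OF assms(3)]
  have "((a \<otimes>\<^bsub>M\<^esub> b) \<otimes>\<^bsub>M\<^esub> c) (s, u) =
      (\<Oplus>t\<in>\<Lambda>. (\<Oplus>v\<in>\<Lambda>. a (s, v) \<otimes> b (v, t)) \<otimes> c (t, u))"
    using assms su by (simp add: mult_entry mult_matrix_closed cong: finsum_cong)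
  also have "\<dots> = (\<Oplus>t\<in>\<Lambda>. \<Oplus>v\<in>\<Lambda>. a (s, v) \<otimes> (b (v, t) \<otimes> c (t, u)))"
    using su finite_index
    by (intro finsum_cong')
      (auto simp: finsum_ldistr m_assoc Pi_iff intro!: finsum_closed finsum_cong')
  also have "\<dots> = (\<Oplus>v\<in>\<Lambda>. \<Oplus>t\<in>\<Lambda>. a (s, v) \<otimes> (b (v, t) \<otimes> c (t, u)))"
    using su finite_index by (intro finsum_swap) auto
  also have "\<dots> = (\<Oplus>v\<in>\<Lambda>. a (s, v) \<otimes> (\<Oplus>t\<in>\<Lambda>. b (v, t) \<otimes> c (t, u)))"
    using su finite_index by (intro finsum_cong') (auto simp: finsum_rdistr Pi_iff)
  also have "\<dots> = (a \<otimes>\<^bsub>M\<^esub> (b \<otimes>\<^bsub>M\<^esub> c)) (s, u)"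
    using assms su by (simp add: mult_entry mult_matrix_closed cong: finsum_cong)
  finally show "((a \<otimes>\<^bsub>M\<^esub> b) \<otimes>\<^bsub>M\<^esub> c) (s, u) = (a \<otimes>\<^bsub>M\<^esub> (b \<otimes>\<^bsub>M\<^esub> c)) (s, u)" .
qed (use assms mult_matrix_closed in auto)

lemma ring_matrix: "ring M"
proof (rule ringI)
  show "abelian_group M"
  proof (rule abelian_groupI)
    show "\<exists>y\<in>carrier M. y \<oplus>\<^bsub>M\<^esub> x = \<zero>\<^bsub>M\<^esub>" if "x \<in> carrier M" for x
      using uminus_matrix_closed[OF that] uminus_matrix_l_neg[OF that] by blast
    show "\<zero>\<^bsub>M\<^esub> \<oplus>\<^bsub>M\<^esub> x = x" if "x \<in> carrier M" for x
    proof (rule matrix_eqI)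
      show "(\<zero>\<^bsub>M\<^esub> \<oplus>\<^bsub>M\<^esub> x) (s, t) = x (s, t)" if "s \<in> \<Lambda>" "t \<in> \<Lambda>" for s t
        using that entry_closed[OF \<open>x \<in> carrier M\<close>] by (simp add: add_matrix zero_matrix)
    qed (use that add_matrix_closed zero_matrix_closed in auto)
    show "x \<oplus>\<^bsub>M\<^esub> y = y \<oplus>\<^bsub>M\<^esub> x" if "x \<in> carrier M" "y \<in> carrier M" for x y
      using entry_closed[OF that(1)] entry_closed[OF that(2)]
      by (auto simp: add_matrix fun_eq_iff a_comm)
    show "x \<oplus>\<^bsub>M\<^esub> y \<oplus>\<^bsub>M\<^esub> z = x \<oplus>\<^bsub>M\<^esub> (y \<oplus>\<^bsub>M\<^esub> z)"
      if "x \<in> carrier M" "y \<in> carrier M" "z \<in> carrier M" for x y z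
      using entry_closed[OF that(1)] entry_closed[OF that(2)] entry_closed[OF that(3)]
      by (auto simp: add_matrix fun_eq_iff a_assoc)
  qed (auto intro: add_matrix_closed zero_matrix_closed)
next
  show "monoid M"
  proof (rule monoidI)
    fix a assume a: "a \<in> carrier M"
    note [simp] = entry_closed[OF a]
    show "a \<otimes>\<^bsub>M\<^esub> \<one>\<^bsub>M\<^esub> = a"
    proof (rule matrix_eqI)
      fix s u assume su: "s \<in> \<Lambda>" "u \<in> \<Lambda>"
      have "(a \<otimes>\<^bsub>M\<^esub> \<one>\<^bsub>M\<^esub>) (s, u) = (\<Oplus>t\<in>\<Lambda>. if t = u then a (s, t) else \<zero>)"
        unfolding mult_entry[OF a one_matrix_closed su]
        using su by (intro finsum_cong') (auto simp: one_entry)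
      also have "\<dots> = a (s, u)"
        using su finite_index by (intro add.finprod_singleton_swap) auto
      finally show "(a \<otimes>\<^bsub>M\<^esub> \<one>\<^bsub>M\<^esub>) (s, u) = a (s, u)" .
    qed (use a mult_matrix_closed one_matrix_closed in auto)
    show "\<one>\<^bsub>M\<^esub> \<otimes>\<^bsub>M\<^esub> a = a"
    proof (rule matrix_eqI)
      fix s u assume su: "s \<in> \<Lambda>" "u \<in> \<Lambda>"
      have "(\<one>\<^bsub>M\<^esub> \<otimes>\<^bsub>M\<^esub> a) (s, u) = (\<Oplus>t\<in>\<Lambda>. if s = t then a (t, u) else \<zero>)"
        unfolding mult_entry[OF one_matrix_closed a su]
        using su by (intro finsum_cong') (auto simp: one_entry)
      also have "\<dots> = a (s, u)"
        using su finite_index by (intro add.finprod_singleton) auto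
      finally show "(\<one>\<^bsub>M\<^esub> \<otimes>\<^bsub>M\<^esub> a) (s, u) = a (s, u)" .
    qed (use a mult_matrix_closed one_matrix_closed in auto)
  qed (auto intro: mult_matrix_closed one_matrix_closed mult_matrix_assoc)
next
  fix x y z assume xyz: "x \<in> carrier M" "y \<in> carrier M" "z \<in> carrier M"
  note [simp] = entry_closed[OF xyz(1)] entry_closed[OF xyz(2)] entry_closed[OF xyz(3)]
  have add_entry: "(a \<oplus>\<^bsub>M\<^esub> b) (s, t) = a (s, t) \<oplus> b (s, t)" if "s \<in> \<Lambda>" "t \<in> \<Lambda>" for a b s t
    using that by (simp add: add_matrix)
  show "(x \<oplus>\<^bsub>M\<^esub> y) \<otimes>\<^bsub>M\<^esub> z = x \<otimes>\<^bsub>M\<^esub> z \<oplus>\<^bsub>M\<^esub> y \<otimes>\<^bsub>M\<^esub> z"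
  proof (rule matrix_eqI)
    fix s u assume su: "s \<in> \<Lambda>" "u \<in> \<Lambda>"
    have "((x \<oplus>\<^bsub>M\<^esub> y) \<otimes>\<^bsub>M\<^esub> z) (s, u) =
        (\<Oplus>t\<in>\<Lambda>. x (s, t) \<otimes> z (t, u) \<oplus> y (s, t) \<otimes> z (t, u))"
      unfolding mult_entry[OF add_matrix_closed[OF xyz(1,2)] xyz(3) su]
      using su by (intro finsum_cong') (auto simp: add_entry l_distr)
    also have "\<dots> = (\<Oplus>t\<in>\<Lambda>. x (s, t) \<otimes> z (t, u)) \<oplus> (\<Oplus>t\<in>\<Lambda>. y (s, t) \<otimes> z (t, u))"
      using su by (intro finsum_addf) auto
    finally show "((x \<oplus>\<^bsub>M\<^esub> y) \<otimes>\<^bsub>M\<^esub> z) (s, u) = (x \<otimes>\<^bsub>M\<^esub> z \<oplus>\<^bsub>M\<^esub> y \<otimes>\<^bsub>M\<^esub> z) (s, u)"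
      using su xyz by (simp add: add_entry mult_entry)
  qed (use xyz mult_matrix_closed add_matrix_closed in auto)
  show "z \<otimes>\<^bsub>M\<^esub> (x \<oplus>\<^bsub>M\<^esub> y) = z \<otimes>\<^bsub>M\<^esub> x \<oplus>\<^bsub>M\<^esub> z \<otimes>\<^bsub>M\<^esub> y"
  proof (rule matrix_eqI)
    fix s u assume su: "s \<in> \<Lambda>" "u \<in> \<Lambda>"
    have "(z \<otimes>\<^bsub>M\<^esub> (x \<oplus>\<^bsub>M\<^esub> y)) (s, u) =
        (\<Oplus>t\<in>\<Lambda>. z (s, t) \<otimes> x (t, u) \<oplus> z (s, t) \<otimes> y (t, u))"
      unfolding mult_entry[OF xyz(3) add_matrix_closed[OF xyz(1,2)] su]
      using su by (intro finsum_cong') (auto simp: add_entry r_distr)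
    also have "\<dots> = (\<Oplus>t\<in>\<Lambda>. z (s, t) \<otimes> x (t, u)) \<oplus> (\<Oplus>t\<in>\<Lambda>. z (s, t) \<otimes> y (t, u))"
      using su by (intro finsum_addf) auto
    finally show "(z \<otimes>\<^bsub>M\<^esub> (x \<oplus>\<^bsub>M\<^esub> y)) (s, u) = (z \<otimes>\<^bsub>M\<^esub> x \<oplus>\<^bsub>M\<^esub> z \<otimes>\<^bsub>M\<^esub> y) (s, u)"
      using su xyz by (simp add: add_entry mult_entry)
  qed (use xyz mult_matrix_closed add_matrix_closed in auto)
qed

text \<open>Negation in \<open>M\<close> is the abstract inverse of the additive group; uniqueness
  of inverses identifies it with the entrywise one.\<close>

lemma uminus_matrix:
  assumes "a \<in> carrier M"
  shows "\<ominus>\<^bsub>M\<^esub> a = (\<lambda>p\<in>\<Lambda> \<times> \<Lambda>. \<ominus> a p)"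
proof -
  interpret M: ring M by (rule ring_matrix)
  show ?thesis
    using M.minus_equality[OF uminus_matrix_l_neg[OF assms] assms uminus_matrix_closed[OF assms]] .
qed

lemma topspace_matrix:
  assumes "topspace T = carrier P"
  shows "topspace (preorder_matrix_topology \<Lambda> r P T) = carrier M"
proof -
  have "carrier M \<subseteq> \<Lambda> \<times> \<Lambda> \<rightarrow>\<^sub>E carrier P"
    by (simp only: subset_iff carrier_matrix_iff) simp
  then show ?thesis
    by (simp add: preorder_matrix_topology_def assms Int_absorb1)
qed

lemma continuous_map_entry:
  assumes "p \<in> \<Lambda> \<times> \<Lambda>"
  shows "continuous_map (preorder_matrix_topology \<Lambda> r P T) T (\<lambda>a. a p)"
  unfolding preorder_matrix_topology_def
  using assms by (intro continuous_map_from_subtopology continuous_map_product_projection)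

lemma continuous_map_into_matrix:
  assumes "\<And>x. x \<in> topspace X \<Longrightarrow> f x \<in> carrier M"
    and "\<And>s t. s \<in> \<Lambda> \<Longrightarrow> t \<in> \<Lambda> \<Longrightarrow> continuous_map X T (\<lambda>x. f x (s, t))"
  shows "continuous_map X (preorder_matrix_topology \<Lambda> r P T) f"
  unfolding preorder_matrix_topology_def continuous_map_in_subtopology continuous_map_componentwise
  using assms by (auto simp: carrier_matrix_iff PiE_iff)

lemma topological_ring_matrix:
  assumes "topological_ring P T"
  shows "topological_ring M (preorder_matrix_topology \<Lambda> r P T)"
proof -
  let ?T = "preorder_matrix_topology \<Lambda> r P T"
  interpret M: ring M by (rule ring_matrix)
  have T: "topspace T = carrier P" "Hausdorff_space T"
    "continuous_map (prod_topology T T) T (\<lambda>(x, y). x \<oplus> y)"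
    "continuous_map (prod_topology T T) T (\<lambda>(x, y). x \<otimes> y)"
    "continuous_map T T (\<lambda>x. \<ominus> x)"
    using assms by (auto simp: topological_ring_def topological_group_def a_inv_def)
  note top = topspace_matrix[OF T(1)]
  have fst: "continuous_map (prod_topology ?T ?T) T (\<lambda>z. fst z p)"
    and snd: "continuous_map (prod_topology ?T ?T) T (\<lambda>z. snd z p)" if "p \<in> \<Lambda> \<times> \<Lambda>" for p
    using continuous_map_compose[OF continuous_map_fst continuous_map_entry[OF that]]
      continuous_map_compose[OF continuous_map_snd continuous_map_entry[OF that]]
    by (auto simp: o_def)
  have "Hausdorff_space ?T"
    unfolding preorder_matrix_topology_def
    using T(2) by (intro Hausdorff_space_subtopology) (auto simp: Hausdorff_space_product_topology)
  moreover have "continuous_map (prod_topology ?T ?T) ?T (\<lambda>z. fst z \<oplus>\<^bsub>M\<^esub> snd z)"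
  proof (rule continuous_map_into_matrix)
    fix s t assume "s \<in> \<Lambda>" "t \<in> \<Lambda>"
    then show "continuous_map (prod_topology ?T ?T) T (\<lambda>z. (fst z \<oplus>\<^bsub>M\<^esub> snd z) (s, t))"
      using continuous_map_binop[OF T(3) fst snd, of "(s, t)" "(s, t)"] by (simp add: add_matrix)
  qed (auto simp: top)
  moreover have "continuous_map (prod_topology ?T ?T) ?T (\<lambda>z. fst z \<otimes>\<^bsub>M\<^esub> snd z)"
  proof (rule continuous_map_into_matrix)
    fix s u assume su: "s \<in> \<Lambda>" "u \<in> \<Lambda>"
    \<comment> \<open>This sum is known to be the entry of the product only for matrices in
      \<open>carrier M\<close>, which is exactly the underlying space;
      \<open>continuous_map_eq\<close> then transfers continuity.\<close>
    have "continuous_map (prod_topology ?T ?T) T (\<lambda>z. \<Oplus>t\<in>\<Lambda>. fst z (s, t) \<otimes> snd z (t, u))"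
      using T su
      by (intro add.continuous_map_finprod[simplified] continuous_map_binop[OF T(4)] fst snd) auto
    then show "continuous_map (prod_topology ?T ?T) T (\<lambda>z. (fst z \<otimes>\<^bsub>M\<^esub> snd z) (s, u))"
      by (rule continuous_map_eq) (use su in \<open>auto simp: top mult_entry\<close>)
  qed (auto simp: top)
  moreover have "continuous_map ?T ?T (\<lambda>a. \<ominus>\<^bsub>M\<^esub> a)"
  proof (rule continuous_map_into_matrix)
    fix s t assume st: "s \<in> \<Lambda>" "t \<in> \<Lambda>"
    have "continuous_map ?T T (\<lambda>a. \<ominus> a (s, t))"
      using continuous_map_compose[OF continuous_map_entry T(5), of "(s, t)"] st by (simp add: o_def)
    then show "continuous_map ?T T (\<lambda>a. (\<ominus>\<^bsub>M\<^esub> a) (s, t))"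
      by (rule continuous_map_eq) (use st in \<open>auto simp: top uminus_matrix\<close>)
  qed (auto simp: top)
  ultimately show ?thesis
    using M.a_group top ring_matrix
    by (auto simp: topological_ring_def topological_group_def a_inv_def case_prod_unfold)
qed

end

section \<open>The topological group of units\<close>

theorem corollary5p2:
  fixes P :: "('a, 'm) ring_scheme" and T :: "'a topology"
    and \<Lambda> :: "'i set" and r :: "'i rel"
  assumes "cring P"
    and "absolute_topological_ring P T"
    and "finite \<Lambda>"
    and "preorder_on \<Lambda> r"
  shows "absolute_topological_ring (preorder_matrix_ring \<Lambda> r P) (preorder_matrix_topology \<Lambda> r P T)"
proof -
  interpret cring P by fact
  interpret preorder_matrices P \<Lambda> r
    using assms(3,4) by (intro preorder_matrices.intro preorder_matrices_axioms.intro ring_axioms)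
  interpret M: ring M by (rule ring_matrix)
  let ?T = "preorder_matrix_topology \<Lambda> r P T"
  let ?U = "subtopology ?T (Units M)" and ?V = "subtopology T (Units P)"
  have P: "topological_ring P T" "topological_group (units_of P) ?V"
    using assms(2) by (auto simp: absolute_topological_ring_def)
  note TM = topological_ring_matrix[OF P(1)]
  have T: "topspace T = carrier P"
    "continuous_map (prod_topology T T) T (\<lambda>(x, y). x \<otimes>\<^bsub>P\<^esub> y)"
    "continuous_map (prod_topology T T) T (\<lambda>(x, y). x \<oplus>\<^bsub>P\<^esub> y)"
    using P(1) by (auto simp: topological_ring_def topological_group_def)
  \<comment> \<open>The hypothesis concerns inversion in the group \<open>units_of P\<close>; on
    units it agrees with inversion in \<open>P\<close>.\<close>
  have inv: "continuous_map ?V ?V (\<lambda>x. inv\<^bsub>P\<^esub> x)"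
  proof (rule continuous_map_eq)
    show "continuous_map ?V ?V (\<lambda>x. inv\<^bsub>units_of P\<^esub> x)"
      using P(2) by (simp add: topological_group_def)
  qed (auto simp: units_of_inv)
  have topU: "topspace ?U = Units M"
    using topspace_matrix[OF T(1)] M.Units_closed by auto
  have entry: "continuous_map ?U T (\<lambda>a. a p)" if "p \<in> \<Lambda> \<times> \<Lambda>" for p
    using continuous_map_entry[OF that] by (rule continuous_map_from_subtopology)
  have prod: "(\<Oplus>\<^bsub>P\<^esub>t\<in>\<Lambda>. a (s, t) \<otimes>\<^bsub>P\<^esub> (inv\<^bsub>M\<^esub> a) (t, u)) =
      (if s = u then \<one>\<^bsub>P\<^esub> else \<zero>\<^bsub>P\<^esub>)" if "a \<in> Units M" "s \<in> \<Lambda>" "u \<in> \<Lambda>" for a s u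
    using mult_entry[of a "inv\<^bsub>M\<^esub> a" s u] that one_entry[of s u] M.Units_closed M.Units_inv_closed
    by simp
  have det_unit: "perm_det \<Lambda> a \<in> Units P" if "a \<in> Units M" for a
    using that prod[OF that] entry_closed[OF M.Units_closed] entry_closed[OF M.Units_inv_closed]
    by (intro perm_det_Units[OF assms(3), where b = "inv\<^bsub>M\<^esub> a"]) auto
  have "continuous_map ?U T (\<lambda>a. perm_det \<Lambda> a)"
    using entry by (intro continuous_map_perm_det[OF T]) auto
  \<comment> \<open>Restricting the codomain to the units is what allows composition with the
    continuous inversion of \<open>P\<close>.\<close>
  then have "continuous_map ?U ?V (\<lambda>a. perm_det \<Lambda> a)"
    using det_unit topU by (auto simp: continuous_map_in_subtopology)
  from continuous_map_compose[OF this inv]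
  have inv_det: "continuous_map ?U T (\<lambda>a. inv\<^bsub>P\<^esub> perm_det \<Lambda> a)"
    by (simp add: o_def continuous_map_in_subtopology)
  \<comment> \<open>The inverse is taken in \<open>M\<close>, so it respects the preorder
    automatically and only its entries need a continuous formula.\<close>
  have "continuous_map ?U ?T (\<lambda>a. inv\<^bsub>M\<^esub> a)"
  proof (rule continuous_map_into_matrix)
    fix i k assume ik: "i \<in> \<Lambda>" "k \<in> \<Lambda>"
    let ?c = "\<lambda>a. \<lambda>(s, t). if t = i then if s = k then \<one>\<^bsub>P\<^esub> else \<zero>\<^bsub>P\<^esub> else a (s, t)"
    \<comment> \<open>Each entry of the auxiliary matrix is either a constant or an entry of
      \<open>a\<close>.\<close>
    have "continuous_map ?U T (\<lambda>a. ?c a (s, t))" if "s \<in> \<Lambda>" "t \<in> \<Lambda>" for s t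
      using entry that T(1) by (cases "t = i") auto
    then have "continuous_map ?U T (\<lambda>a. inv\<^bsub>P\<^esub> perm_det \<Lambda> a \<otimes>\<^bsub>P\<^esub> perm_det \<Lambda> (?c a))"
      by (intro continuous_map_binop[OF T(2)] inv_det continuous_map_perm_det[OF T])
    then show "continuous_map ?U T (\<lambda>a. (inv\<^bsub>M\<^esub> a) (i, k))"
    proof (rule continuous_map_eq)
      fix a assume "a \<in> topspace ?U"
      then have a: "a \<in> Units M"
        by (simp only: topU)
      have cramer: "perm_det \<Lambda> a \<otimes>\<^bsub>P\<^esub> (inv\<^bsub>M\<^esub> a) (i, k) = perm_det \<Lambda> (?c a)"
        using a prod[OF a] entry_closed[OF M.Units_closed] entry_closed[OF M.Units_inv_closed] ik
        by (intro perm_det_cramer[OF assms(3)]) auto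
      \<comment> \<open>Cramer's rule gives the entry multiplied by the determinant, and the
        determinant is a unit that can be cancelled.\<close>
      show "inv\<^bsub>P\<^esub> perm_det \<Lambda> a \<otimes>\<^bsub>P\<^esub> perm_det \<Lambda> (?c a) = (inv\<^bsub>M\<^esub> a) (i, k)"
        unfolding cramer[symmetric]
        using det_unit[OF a] entry_closed[OF M.Units_inv_closed[OF a] ik]
        by (simp add: Units_closed flip: m_assoc)
    qed
  qed (use topU in auto)
  then have "continuous_map ?U ?U (\<lambda>a. inv\<^bsub>M\<^esub> a)"
    using topU by (auto simp: continuous_map_in_subtopology)
  then have invU: "continuous_map ?U ?U (\<lambda>a. inv\<^bsub>units_of M\<^esub> a)"
    by (rule continuous_map_eq) (use topU in \<open>auto simp: M.units_of_inv\<close>)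
  \<comment> \<open>The product of two subspaces is a subspace of the product, so multiplication of
    units is a restriction of the ring multiplication.\<close>
  have "continuous_map (prod_topology ?U ?U) ?T (\<lambda>(x, y). x \<otimes>\<^bsub>M\<^esub> y)"
    using TM unfolding prod_topology_subtopology
    by (intro continuous_map_from_subtopology) (simp add: topological_ring_def)
  then have "continuous_map (prod_topology ?U ?U) ?U (\<lambda>(x, y). x \<otimes>\<^bsub>M\<^esub> y)"
    using topU by (auto simp: continuous_map_in_subtopology simp del: topspace_subtopology)
  moreover have "Hausdorff_space ?U"
    using TM by (auto simp: topological_ring_def topological_group_def intro: Hausdorff_space_subtopology)
  ultimately show ?thesis
    using TM invU topU M.units_group
    by (auto simp: absolute_topological_ring_def topological_group_def units_of_carrier units_of_mult
        simp del: topspace_subtopology)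
qed

end
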